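(* For every nondeterministic register automaton with at most one register and without disequality guards, there exists a deterministic register set automaton accepting the same language.
   Context: Fix a finite nonempty alphabet $\Sigma$ and an infinite data domain $\mathbb{D}$. A (nondeterministic) register automaton (NRA) is a tuple $(Q,R,\Delta,I,F)$ ($Q$ finite states, $R$ finite registers, $I,F\subseteq Q$) with transitions $q\xrightarrow{a\mid G^{=},G^{\neq},up}s$, $a\in\Sigma$, $G^{=},G^{\neq}\subseteq R$ disjoint, $up\colon R\to R\cup\{\mathit{in},\bot\}$. Configurations are $(q,f)$, $f\colon R\to\mathbb{D}\cup\{\bot\}$, initially all registers $\bot$ and $q\in I$. A step over $(a,d)$ is possible iff $d=f(r)$ for $r\in G^{=}$ and $d\neq f(r)$ for $r\in G^{\neq}$; afterwards $r$ holds $f(up(r))$ if $up(r)\in R$, $d$ if $up(r)=\mathit{in}$, $\bot$ if $up(r)=\bot$. A word is accepted if some run over it ends in $F$. "Without disequality guards" means $G^{\neq}=\emptyset$ on every transition. A register set automaton (RsA) $(Q,R,\Delta,I,F)$ has transitions $q\xrightarrow{a\mid G^{\in},G^{\notin},up}s$ with $G^{\in},G^{\notin}\subseteq R$ disjoint, $up\colon R\to 2^{R\cup\{\mathit{in}\}}$; configurations $(q,f)$ with $f\colon R\to 2^{\mathbb{D}}$, initially all empty; a step over $(a,d)$ requires $d\in f(r)$ for $r\in G^{\in}$ and $d\notin f(r)$ for $r\in G^{\notin}$, and sets each $r$ to $\bigcup\{f(r')\mid r'\in R\cap up(r)\}$ plus $d$ if $\mathit{in}\in up(r)$; acceptance as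 for NRA. An RsA is deterministic if for every $q$, $a$ and any two distinct transitions from $q$ over $a$ with guards $(G^{\in}_1,G^{\notin}_1)$ and $(G^{\in}_2,G^{\notin}_2)$, $G^{\in}_1\cap G^{\notin}_2\neq\emptyset$ or $G^{\in}_2\cap G^{\notin}_1\neq\emptyset$. *)

theory Defs
  imports "HOL-Library.FuncSet" "HOL-Library.Infinite_Typeclass"
begin

text \<open>
  The alphabet is a type of class \<open>finite\<close>, the data domain a type of class \<open>infinite\<close>; words are
  lists over their product.  The two automaton models share one record, differing only in the type
  of the update of a single register.  Transitions are tuples
  (source, letter, positive guard, negative guard, update, target).
\<close>

datatype 'r src = Reg 'r | In

type_synonym ('q, 'r, 'a, 'u) transition =
  "'q \<times> 'a \<times> 'r set \<times> 'r set \<times> ('r \<Rightarrow> 'u) \<times> 'q"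

record ('q, 'r, 'a, 'u) automaton =
  states :: "'q set"
  registers :: "'r set"
  transitions :: "('q, 'r, 'a, 'u) transition set"
  initial :: "'q set"
  accepting :: "'q set"

text \<open>
  In NRA updates and register contents, \<open>None\<close> stands for \<open>\<bottom>\<close>.
\<close>

type_synonym ('q, 'r, 'a) nra = "('q, 'r, 'a, 'r src option) automaton"
type_synonym ('q, 'r, 'a) rsa = "('q, 'r, 'a, 'r src set) automaton"

text \<open>
  Updates are maps with domain \<open>R\<close>, hence extensional outside \<open>R\<close>: otherwise one transition would
  have many distinct representations, which would distort determinism.  As \<open>Q\<close>, \<open>R\<close> and the
  alphabet are finite, so is the set of transitions.
\<close>

definition wf_automaton :: "'u set \<Rightarrow> ('q, 'r, 'a, 'u) automaton \<Rightarrow> bool" where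
  "wf_automaton U A \<longleftrightarrow>
     finite (states A) \<and> finite (registers A) \<and>
     initial A \<subseteq> states A \<and> accepting A \<subseteq> states A \<and>
     (\<forall>(q, a, P, N, up, s) \<in> transitions A.
        q \<in> states A \<and> s \<in> states A \<and>
        P \<subseteq> registers A \<and> N \<subseteq> registers A \<and> P \<inter> N = {} \<and>
        up \<in> registers A \<rightarrow>\<^sub>E U)"

definition is_nra :: "('q, 'r, 'a) nra \<Rightarrow> bool" where
  "is_nra A \<longleftrightarrow> wf_automaton (Some ` Reg ` registers A \<union> {Some In, None}) A"

definition is_rsa :: "('q, 'r, 'a) rsa \<Rightarrow> bool" where
  "is_rsa A \<longleftrightarrow> wf_automaton (Pow (Reg ` registers A \<union> {In})) A"

inductive run :: "('c \<Rightarrow> 'l \<Rightarrow> 'c \<Rightarrow> bool) \<Rightarrow> 'c \<Rightarrow> 'l list \<Rightarrow> 'c \<Rightarrow> bool"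
  for step where
  Nil: "run step c [] c"
| Cons: "step c x c' \<Longrightarrow> run step c' w c'' \<Longrightarrow> run step c (x # w) c''"

fun nra_update :: "('r \<Rightarrow> 'd option) \<Rightarrow> 'd \<Rightarrow> 'r src option \<Rightarrow> 'd option" where
  "nra_update f d None = None"
| "nra_update f d (Some In) = Some d"
| "nra_update f d (Some (Reg r)) = f r"

definition nra_step :: "('q, 'r, 'a) nra \<Rightarrow>
    'q \<times> ('r \<Rightarrow> 'd option) \<Rightarrow> 'a \<times> 'd \<Rightarrow> 'q \<times> ('r \<Rightarrow> 'd option) \<Rightarrow> bool" where
  "nra_step A = (\<lambda>(q, f) (a, d) (s, f').
     \<exists>E N up. (q, a, E, N, up, s) \<in> transitions A \<and>
       (\<forall>r\<in>E. f r = Some d) \<and> (\<forall>r\<in>N. f r \<noteq> Some d) \<and>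
       f' = (\<lambda>r\<in>registers A. nra_update f d (up r)))"

definition nra_lang :: "('q, 'r, 'a) nra \<Rightarrow> ('a \<times> 'd) list set" where
  "nra_lang A = {w. \<exists>q\<in>initial A. \<exists>s\<in>accepting A. \<exists>f.
     run (nra_step A) (q, \<lambda>r\<in>registers A. None) w (s, f)}"

definition rsa_update :: "('r \<Rightarrow> 'd set) \<Rightarrow> 'd \<Rightarrow> 'r src set \<Rightarrow> 'd set" where
  "rsa_update f d u = \<Union> {f r | r. Reg r \<in> u} \<union> (if In \<in> u then {d} else {})"

definition rsa_step :: "('q, 'r, 'a) rsa \<Rightarrow>
    'q \<times> ('r \<Rightarrow> 'd set) \<Rightarrow> 'a \<times> 'd \<Rightarrow> 'q \<times> ('r \<Rightarrow> 'd set) \<Rightarrow> bool" where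
  "rsa_step A = (\<lambda>(q, f) (a, d) (s, f').
     \<exists>P N up. (q, a, P, N, up, s) \<in> transitions A \<and>
       (\<forall>r\<in>P. d \<in> f r) \<and> (\<forall>r\<in>N. d \<notin> f r) \<and>
       f' = (\<lambda>r\<in>registers A. rsa_update f d (up r)))"

definition rsa_lang :: "('q, 'r, 'a) rsa \<Rightarrow> ('a \<times> 'd) list set" where
  "rsa_lang A = {w. \<exists>q\<in>initial A. \<exists>s\<in>accepting A. \<exists>f.
     run (rsa_step A) (q, \<lambda>r\<in>registers A. {}) w (s, f)}"

definition no_disequality_guards :: "('q, 'r, 'a) nra \<Rightarrow> bool" where
  "no_disequality_guards A \<longleftrightarrow> (\<forall>(q, a, E, N, up, s) \<in> transitions A. N = {})"

text \<open>
  Determinism constrains the transitions only, not the number of initial states.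
\<close>

definition deterministic_rsa :: "('q, 'r, 'a) rsa \<Rightarrow> bool" where
  "deterministic_rsa A \<longleftrightarrow>
     (\<forall>q a P1 N1 up1 s1 P2 N2 up2 s2.
        (q, a, P1, N1, up1, s1) \<in> transitions A \<longrightarrow>
        (q, a, P2, N2, up2, s2) \<in> transitions A \<longrightarrow>
        (P1, N1, up1, s1) \<noteq> (P2, N2, up2, s2) \<longrightarrow>
        P1 \<inter> N2 \<noteq> {} \<or> P2 \<inter> N1 \<noteq> {})"

end

theory Submission
  imports Defs "HOL-Library.Nat_Bijection"
begin

text \<open>
  The automaton is determinised by a subset construction.  With a single register, the set of
  reachable configurations is a set of pairs of a state and a register content.  The RsA has one
  register per NRA state \<open>q\<close>, holding all data values that occur with \<open>q\<close>; its control state records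
  the set \<open>S\<close> of states reachable with an empty register and the set \<open>T\<close> of states reachable with
  some value.  Reading \<open>d\<close>, a transition guarded by equality is enabled iff \<open>d\<close> is in the register
  of its source, so the subset of RsA registers containing \<open>d\<close>, which the guards can test exactly,
  together with \<open>S\<close> and \<open>T\<close> determines the next set of configurations.  A disequality guard
  would instead remove a single value from a register, which no RsA update can do.
\<close>

section \<open>Runs, functional simulations and sets of reachable configurations\<close>

inductive_cases run_NilE: "run step c [] c'"
inductive_cases run_ConsE: "run step c (x # w) c'"

lemma run_Nil_iff [simp]: "run step c [] c' \<longleftrightarrow> c' = c"
  by (auto intro: run.Nil elim: run_NilE)

lemma run_Cons_iff [simp]:
  "run step c (x # w) c'' \<longleftrightarrow> (\<exists>c'. step c x c' \<and> run step c' w c'')"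
  by (auto intro: run.Cons elim: run_ConsE)

text \<open>Steps from \<open>h c\<close> are exactly the images of steps from \<open>c\<close>, and
  \<open>P\<close> is preserved, so runs transfer letter by letter. \<open>h\<close> may identify
  configurations. It is applied with \<open>h = conf\<close> to the RsA and with a decoding of
  numbered states to the NRA.\<close>

lemma run_simulation:
  assumes "\<And>c x y. P c \<Longrightarrow> step (h c) x y \<longleftrightarrow> (\<exists>c'. y = h c' \<and> step' c x c')"
    and "\<And>c x c'. P c \<Longrightarrow> step' c x c' \<Longrightarrow> P c'"
    and "P c"
  shows "run step (h c) w y \<longleftrightarrow> (\<exists>c'. y = h c' \<and> run step' c w c')"
  using \<open>P c\<close>
proof (induction w arbitrary: c)
  case (Cons x w)
  have "run step (h c) (x # w) y \<longleftrightarrow> (\<exists>c'. step' c x c' \<and> run step (h c') w y)"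
    using assms(1)[OF Cons.prems] by auto
  also have "\<dots> \<longleftrightarrow> (\<exists>c'. step' c x c' \<and> (\<exists>c''. y = h c'' \<and> run step' c' w c''))"
    using Cons.IH assms(2)[OF Cons.prems] by blast
  finally show ?case by auto
qed simp

definition post :: "('c \<Rightarrow> 'l \<Rightarrow> 'c \<Rightarrow> bool) \<Rightarrow> 'l \<Rightarrow> 'c set \<Rightarrow> 'c set" where
  "post step x C = {c'. \<exists>c\<in>C. step c x c'}"

text \<open>The subset construction on the configuration graph: what \<open>C\<close> reaches over
  \<open>x # w\<close> is what \<open>post step x C\<close> reaches over \<open>w\<close>.\<close>

lemma run_post:
  "run (\<lambda>C x C'. C' = post step x C) C w C' \<longleftrightarrow> C' = {c'. \<exists>c\<in>C. run step c w c'}"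
proof (induction w arbitrary: C)
  case (Cons x w)
  have "{c'. \<exists>c\<in>post step x C. run step c w c'} = {c'. \<exists>c\<in>C. run step c (x # w) c'}"
    by (auto simp: post_def)
  then show ?case by (simp add: Cons.IH)
qed auto


section \<open>Determinisation of one-register machines\<close>

text \<open>
  In a move \<open>(q, a, g, u, s)\<close>, \<open>g\<close> says whether there is an equality guard; every \<open>Some (Reg r)\<close>
  as \<open>u\<close> means keeping the content of the only register, whatever \<open>r\<close> is.
\<close>

locale one_register =
  fixes k :: nat
    and M :: "(nat \<times> 'a \<times> bool \<times> 'r src option \<times> nat) set"
    and I F :: "nat set"
  assumes moves_bounded: "(q, a, g, u, s) \<in> M \<Longrightarrow> q < k \<and> s < k"
    and initial_bounded: "I \<subseteq> {..<k}"
    and accepting_bounded: "F \<subseteq> {..<k}"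
begin

definition move_step :: "nat \<times> 'd option \<Rightarrow> 'a \<times> 'd \<Rightarrow> nat \<times> 'd option \<Rightarrow> bool" where
  "move_step = (\<lambda>(q, v) (a, d) (s, v'). \<exists>g u. (q, a, g, u, s) \<in> M \<and>
     (g \<longrightarrow> v = Some d) \<and> v' = nra_update (\<lambda>_. v) d u)"

text \<open>The RsA is to have natural numbers as states. \<open>set_encode\<close> is faithful on
  finite sets only, hence the bounds by \<open>{..<k}\<close> below.\<close>

definition code :: "nat set \<Rightarrow> nat set \<Rightarrow> nat" where
  "code S T = prod_encode (set_encode S, set_encode T)"

text \<open>\<open>G\<close> stands for the states that occur together with the input value.\<close>

definition enabled :: "nat set \<Rightarrow> nat set \<Rightarrow> nat set \<Rightarrow> bool \<Rightarrow> nat set" where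
  "enabled S T G g = (if g then G else S \<union> T)"

definition kept :: "'a \<Rightarrow> nat \<Rightarrow> nat set" where
  "kept a s = {q. \<exists>r. (q, a, False, Some (Reg r), s) \<in> M}"

definition emptied :: "'a \<Rightarrow> nat set \<Rightarrow> nat set \<Rightarrow> nat set \<Rightarrow> nat set" where
  "emptied a S T G = {s. (\<exists>q g. (q, a, g, None, s) \<in> M \<and> q \<in> enabled S T G g) \<or> kept a s \<inter> S \<noteq> {}}"

text \<open>Keeping the content under an equality guard amounts to loading the input value.\<close>

definition loaded :: "'a \<Rightarrow> nat set \<Rightarrow> nat set \<Rightarrow> nat set \<Rightarrow> nat set" where
  "loaded a S T G = {s. (\<exists>q g. (q, a, g, Some In, s) \<in> M \<and> q \<in> enabled S T G g) \<or>
     (\<exists>q r. (q, a, True, Some (Reg r), s) \<in> M \<and> q \<in> G)}"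

definition filled :: "'a \<Rightarrow> nat set \<Rightarrow> nat set \<Rightarrow> nat set \<Rightarrow> nat set" where
  "filled a S T G = loaded a S T G \<union> {s. kept a s \<inter> T \<noteq> {}}"

definition det_update :: "'a \<Rightarrow> nat set \<Rightarrow> nat set \<Rightarrow> nat set \<Rightarrow> nat \<Rightarrow> nat src set" where
  "det_update a S T G =
     (\<lambda>s\<in>{..<k}. Reg ` kept a s \<union> (if s \<in> loaded a S T G then {In} else {}))"

text \<open>The guards of the transition for \<open>G\<close> hold exactly when \<open>G\<close> is
  the set of registers containing the input, so one transition fires on each input.\<close>

definition det :: "(nat, nat, 'a) rsa" where
  "det = \<lparr>
     states = {code S T | S T. S \<subseteq> {..<k} \<and> T \<subseteq> {..<k}},
     registers = {..<k},
     transitions =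
       {(code S T, a, G, {..<k} - G, det_update a S T G, code (emptied a S T G) (filled a S T G))
        | S T a G. S \<subseteq> {..<k} \<and> T \<subseteq> {..<k} \<and> G \<subseteq> {..<k}},
     initial = {code I {}},
     accepting = {code S T | S T. S \<subseteq> {..<k} \<and> T \<subseteq> {..<k} \<and> (S \<union> T) \<inter> F \<noteq> {}}\<rparr>"

text \<open>The second set in the code says which registers are nonempty. Guards cannot test this,
  so the control state tracks it.\<close>

definition conf :: "(nat \<times> 'd option) set \<Rightarrow> nat \<times> (nat \<Rightarrow> 'd set)" where
  "conf C = (code {q. q < k \<and> (q, None) \<in> C} {q. q < k \<and> (\<exists>d. (q, Some d) \<in> C)},
     \<lambda>q\<in>{..<k}. {d. (q, Some d) \<in> C})"

section \<open>Well-formedness and determinism of \<open>det\<close>\<close>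

lemma code_eq_iff:
  assumes "S \<subseteq> {..<k}" "T \<subseteq> {..<k}" "S' \<subseteq> {..<k}" "T' \<subseteq> {..<k}"
  shows "code S T = code S' T' \<longleftrightarrow> S = S' \<and> T = T'"
proof -
  have "finite S" "finite T" "finite S'" "finite T'"
    using assms by (auto intro: finite_subset[OF _ finite_lessThan])
  then show ?thesis by (simp add: code_def set_encode_eq)
qed

lemma kept_bounded: "kept a s \<subseteq> {..<k}"
  using moves_bounded by (auto simp: kept_def)

lemma emptied_bounded: "emptied a S T G \<subseteq> {..<k}"
  using moves_bounded by (fastforce simp: emptied_def kept_def)

lemma filled_bounded: "filled a S T G \<subseteq> {..<k}"
  using moves_bounded by (fastforce simp: filled_def loaded_def kept_def)

lemma registers_det [simp]: "registers det = {..<k}"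
  by (simp add: det_def)

lemma initial_det [simp]: "initial det = {code I {}}"
  by (simp add: det_def)

lemma mem_transitions_det:
  assumes "S \<subseteq> {..<k}" "T \<subseteq> {..<k}"
  shows "(code S T, a, P, N, up, s) \<in> transitions det \<longleftrightarrow>
    P \<subseteq> {..<k} \<and> N = {..<k} - P \<and> up = det_update a S T P \<and>
    s = code (emptied a S T P) (filled a S T P)"
proof -
  have "(code S T, a, P, N, up, s) \<in> transitions det \<longleftrightarrow>
      (\<exists>S' T'. code S T = code S' T' \<and> S' \<subseteq> {..<k} \<and> T' \<subseteq> {..<k} \<and>
        P \<subseteq> {..<k} \<and> N = {..<k} - P \<and> up = det_update a S' T' P \<and>
        s = code (emptied a S' T' P) (filled a S' T' P))"
    by (auto simp: det_def)
  then show ?thesis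
    using code_eq_iff[OF assms] assms by (metis (no_types, lifting))
qed

lemma is_rsa_det: "is_rsa det"
proof -
  have "{code S T | S T. S \<subseteq> {..<k} \<and> T \<subseteq> {..<k}} =
      (\<lambda>(S, T). code S T) ` (Pow {..<k} \<times> Pow {..<k})"
    by auto
  then have "finite {code S T | S T. S \<subseteq> {..<k} \<and> T \<subseteq> {..<k}}"
    by simp
  moreover have "det_update a S T G \<in> {..<k} \<rightarrow>\<^sub>E Pow (Reg ` {..<k} \<union> {In})" for a S T G
    unfolding det_update_def restrict_PiE_iff by (auto dest: subsetD[OF kept_bounded])
  ultimately have "finite (states det)"
    and up: "det_update a S T G \<in> registers det \<rightarrow>\<^sub>E Pow (Reg ` registers det \<union> {In})" for a S T G
    by (simp_all add: det_def)
  moreover have code: "code S T \<in> states det" if "S \<subseteq> {..<k}" "T \<subseteq> {..<k}" for S T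
    using that by (auto simp: det_def)
  moreover have "initial det \<subseteq> states det"
    using code initial_bounded by simp
  moreover have "accepting det \<subseteq> states det"
    by (auto simp: det_def)
  moreover have "q \<in> states det \<and> s \<in> states det \<and> P \<subseteq> registers det \<and> N \<subseteq> registers det \<and>
      P \<inter> N = {} \<and> up \<in> registers det \<rightarrow>\<^sub>E Pow (Reg ` registers det \<union> {In})"
    if t: "(q, a, P, N, up, s) \<in> transitions det" for q a P N up s
  proof -
    obtain S T where ST: "S \<subseteq> {..<k}" "T \<subseteq> {..<k}" "q = code S T"
      using t by (auto simp: det_def)
    moreover from this have "P \<subseteq> {..<k}" "N = {..<k} - P" "up = det_update a S T P"
      "s = code (emptied a S T P) (filled a S T P)"
      using t mem_transitions_det by blast+
    ultimately show ?thesis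
      using up code emptied_bounded filled_bounded by auto
  qed
  ultimately show ?thesis
    unfolding is_rsa_def wf_automaton_def Ball_def split_paired_All prod.case
    using finite_lessThan[of k] registers_det by (intro conjI allI impI) (simp | blast)+
qed

text \<open>Source, letter and \<open>G\<close> determine a transition. Two different sets
  \<open>G\<close> and \<open>H\<close> differ in some register, which one transition requires to
  contain the input and the other forbids.\<close>

lemma deterministic_det: "deterministic_rsa det"
proof -
  have "G = H" if "G \<subseteq> {..<k}" "H \<subseteq> {..<k}" "G \<inter> ({..<k} - H) = {}" "H \<inter> ({..<k} - G) = {}" for G H
    using that by blast
  then show ?thesis
    unfolding deterministic_rsa_def det_def by (auto simp: code_eq_iff) metis+
qed

section \<open>One step of \<open>det\<close> against one application of \<open>post\<close>\<close>

lemma ex_update: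
  "(\<exists>u. P u) \<longleftrightarrow> P None \<or> P (Some In) \<or> (\<exists>r. P (Some (Reg r)))"
  by (metis option.exhaust src.exhaust)

lemma mem_post_move_step:
  "(s, v') \<in> post move_step (a, d) C \<longleftrightarrow>
    v' = None \<and> (\<exists>q g. (q, a, g, None, s) \<in> M \<and> (\<exists>v. (q, v) \<in> C \<and> (g \<longrightarrow> v = Some d))) \<or>
    v' = Some d \<and> (\<exists>q g. (q, a, g, Some In, s) \<in> M \<and> (\<exists>v. (q, v) \<in> C \<and> (g \<longrightarrow> v = Some d))) \<or>
    v' = Some d \<and> (\<exists>q r. (q, a, True, Some (Reg r), s) \<in> M \<and> (q, Some d) \<in> C) \<or>
    (\<exists>q r. (q, a, False, Some (Reg r), s) \<in> M \<and> (q, v') \<in> C)"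
proof -
  have "(s, v') \<in> post move_step (a, d) C \<longleftrightarrow> (\<exists>q v g u. (q, v) \<in> C \<and> (q, a, g, u, s) \<in> M \<and>
      (g \<longrightarrow> v = Some d) \<and> v' = nra_update (\<lambda>_. v) d u)"
    by (simp add: post_def move_step_def Bex_def)
  then show ?thesis
    unfolding ex_update ex_bool_eq nra_update.simps by blast
qed

context
  fixes C :: "(nat \<times> 'd option) set" and d :: 'd and S T G :: "nat set"
  assumes S: "S = {q. q < k \<and> (q, None) \<in> C}"
    and T: "T = {q. q < k \<and> (\<exists>d. (q, Some d) \<in> C)}"
    and G: "G = {q. q < k \<and> (q, Some d) \<in> C}"
begin

text \<open>The sets \<open>S\<close>, \<open>T\<close> and \<open>G\<close> only see states below
  \<open>k\<close>, but the source of a move is such a state.\<close>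

lemma mem_enabled:
  assumes "(q, a, g, u, s) \<in> M"
  shows "q \<in> enabled S T G g \<longleftrightarrow> (\<exists>v. (q, v) \<in> C \<and> (g \<longrightarrow> v = Some d))"
proof -
  have "(\<exists>v. (q, v) \<in> C) \<longleftrightarrow> (q, None) \<in> C \<or> (\<exists>d. (q, Some d) \<in> C)"
    by (metis option.exhaust)
  then show ?thesis
    using moves_bounded[OF assms] by (auto simp: enabled_def S T G)
qed

lemma post_None: "(s, None) \<in> post move_step (a, d) C \<longleftrightarrow> s \<in> emptied a S T G"
proof -
  have "(\<exists>q r. (q, a, False, Some (Reg r), s) \<in> M \<and> (q, None) \<in> C) \<longleftrightarrow> kept a s \<inter> S \<noteq> {}"
    using moves_bounded by (auto simp: kept_def S)
  moreover have "(\<exists>q g. (q, a, g, None, s) \<in> M \<and> (\<exists>v. (q, v) \<in> C \<and> (g \<longrightarrow> v = Some d))) \<longleftrightarrow>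
      (\<exists>q g. (q, a, g, None, s) \<in> M \<and> q \<in> enabled S T G g)"
    using mem_enabled by blast
  ultimately show ?thesis
    unfolding mem_post_move_step emptied_def by auto
qed

lemma post_Some:
  "(s, Some d') \<in> post move_step (a, d) C \<longleftrightarrow>
    d' = d \<and> s \<in> loaded a S T G \<or> (\<exists>q\<in>kept a s. (q, Some d') \<in> C)"
proof -
  have "(\<exists>q r. (q, a, True, Some (Reg r), s) \<in> M \<and> (q, Some d) \<in> C) \<longleftrightarrow>
      (\<exists>q r. (q, a, True, Some (Reg r), s) \<in> M \<and> q \<in> G)"
    using moves_bounded by (auto simp: G)
  moreover have "(\<exists>q r. (q, a, False, Some (Reg r), s) \<in> M \<and> (q, Some d') \<in> C) \<longleftrightarrow>
      (\<exists>q\<in>kept a s. (q, Some d') \<in> C)"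
    by (auto simp: kept_def)
  moreover have "(\<exists>q g. (q, a, g, Some In, s) \<in> M \<and> (\<exists>v. (q, v) \<in> C \<and> (g \<longrightarrow> v = Some d))) \<longleftrightarrow>
      (\<exists>q g. (q, a, g, Some In, s) \<in> M \<and> q \<in> enabled S T G g)"
    using mem_enabled by blast
  ultimately show ?thesis
    unfolding mem_post_move_step loaded_def by auto
qed

text \<open>By \<open>post_Some\<close>, the new values at \<open>s\<close> are a union of old
  registers, plus possibly the input: just the form of an RsA update.\<close>

lemma conf_post:
  "conf (post move_step (a, d) C) = (code (emptied a S T G) (filled a S T G),
     \<lambda>s\<in>{..<k}. rsa_update (\<lambda>q\<in>{..<k}. {d. (q, Some d) \<in> C}) d (det_update a S T G s))"
proof -
  have "{s. s < k \<and> (s, None) \<in> post move_step (a, d) C} = emptied a S T G"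
    using emptied_bounded[of a S T G] by (auto simp: post_None)
  moreover have "{s. s < k \<and> (\<exists>d'. (s, Some d') \<in> post move_step (a, d) C)} = filled a S T G"
  proof -
    have "(\<exists>d'. (s, Some d') \<in> post move_step (a, d) C) \<longleftrightarrow> s \<in> filled a S T G" for s
      unfolding post_Some filled_def using kept_bounded[of a s] by (auto simp: T)
    then show ?thesis
      using filled_bounded[of a S T G] by auto
  qed
  moreover have "{d'. (s, Some d') \<in> post move_step (a, d) C} =
      rsa_update (\<lambda>q\<in>{..<k}. {d. (q, Some d) \<in> C}) d (det_update a S T G s)" if "s < k" for s
    using that kept_bounded[of a s] unfolding post_Some rsa_update_def det_update_def by auto
  ultimately show ?thesis
    by (simp add: conf_def cong: restrict_cong)
qed

end

lemma rsa_step_det: "rsa_step det (conf C) (a, d) y \<longleftrightarrow> y = conf (post move_step (a, d) C)"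
proof -
  define S T G where ST: "S = {q. q < k \<and> (q, None) \<in> C}"
    "T = {q. q < k \<and> (\<exists>d. (q, Some d) \<in> C)}" "G = {q. q < k \<and> (q, Some d) \<in> C}"
  define f where "f = (\<lambda>q\<in>{..<k}. {d. (q, Some d) \<in> C})"
  have conf: "conf C = (code S T, f)"
    by (simp add: conf_def ST f_def)
  have sub: "S \<subseteq> {..<k}" "T \<subseteq> {..<k}" "G \<subseteq> {..<k}"
    by (auto simp: ST)
  \<comment> \<open>Complementary guards leave a single candidate for the transition taken.\<close>
  have guards: "(\<forall>q\<in>H. d \<in> f q) \<and> (\<forall>q\<in>{..<k} - H. d \<notin> f q) \<longleftrightarrow> H = G" if "H \<subseteq> {..<k}" for H
    using that by (auto simp: f_def ST)
  obtain s f' where y: "y = (s, f')" by (cases y)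
  have "rsa_step det (conf C) (a, d) y \<longleftrightarrow>
      (\<exists>H \<subseteq> {..<k}. (\<forall>q\<in>H. d \<in> f q) \<and> (\<forall>q\<in>{..<k} - H. d \<notin> f q) \<and>
         s = code (emptied a S T H) (filled a S T H) \<and>
         f' = (\<lambda>s\<in>{..<k}. rsa_update f d (det_update a S T H s)))"
    unfolding conf y rsa_step_def using mem_transitions_det[OF sub(1,2)]
    by (auto simp: det_def)
  also have "\<dots> \<longleftrightarrow> s = code (emptied a S T G) (filled a S T G) \<and>
         f' = (\<lambda>s\<in>{..<k}. rsa_update f d (det_update a S T G s))"
    using guards sub(3) by blast
  also have "\<dots> \<longleftrightarrow> y = conf (post move_step (a, d) C)"
    unfolding conf_post[OF ST] y f_def by simp
  finally show ?thesis .
qed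

section \<open>The language of \<open>det\<close>\<close>

lemma rsa_lang_det: "rsa_lang det = {w. \<exists>q\<in>I. \<exists>s\<in>F. \<exists>v. run move_step (q, None) w (s, v)}"
proof -
  have run: "run (rsa_step det) (conf C) w y \<longleftrightarrow> y = conf {c'. \<exists>c\<in>C. run move_step c w c'}"
    for C :: "(nat \<times> 'd option) set" and w y
  proof -
    have "run (rsa_step det) (conf C) w y \<longleftrightarrow>
        (\<exists>C'. y = conf C' \<and> run (\<lambda>C x C'. C' = post move_step x C) C w C')"
      \<comment> \<open>\<open>rsa_step_det\<close> holds for every set \<open>C\<close>, so the
        trivial invariant suffices.\<close>
      by (rule run_simulation[where P = "\<lambda>_. True"]) (auto simp: rsa_step_det)
    then show ?thesis by (simp add: run_post)
  qed
  have init: "(code I {}, \<lambda>r\<in>{..<k}. {}) = conf (I \<times> {None :: 'd option})"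
  proof -
    have "{q. q < k \<and> q \<in> I} = I" using initial_bounded by auto
    then show ?thesis by (simp add: conf_def)
  qed
  have acc: "fst (conf C) \<in> accepting det \<longleftrightarrow> (\<exists>s\<in>F. \<exists>v. (s, v) \<in> C)"
    for C :: "(nat \<times> 'd option) set"
  proof -
    define S T where ST: "S = {q. q < k \<and> (q, None) \<in> C}"
      "T = {q. q < k \<and> (\<exists>d. (q, Some d) \<in> C)}"
    have sub: "S \<subseteq> {..<k}" "T \<subseteq> {..<k}" by (auto simp: ST)
    have "fst (conf C) \<in> accepting det \<longleftrightarrow> (\<exists>S' T'. code S T = code S' T' \<and>
        S' \<subseteq> {..<k} \<and> T' \<subseteq> {..<k} \<and> (S' \<union> T') \<inter> F \<noteq> {})"
      by (simp add: conf_def det_def ST)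
    also have "\<dots> \<longleftrightarrow> (S \<union> T) \<inter> F \<noteq> {}"
      using code_eq_iff sub by blast
    also have "\<dots> \<longleftrightarrow> (\<exists>s\<in>F. (s, None) \<in> C \<or> (\<exists>d. (s, Some d) \<in> C))"
      using accepting_bounded by (auto simp: ST)
    also have "\<dots> \<longleftrightarrow> (\<exists>s\<in>F. \<exists>v. (s, v) \<in> C)"
      by (metis option.exhaust)
    finally show ?thesis .
  qed
  show ?thesis
  proof (rule set_eqI)
    fix w :: "('a \<times> 'd) list"
    let ?C = "{c'. \<exists>c\<in>I \<times> {None :: 'd option}. run move_step c w c'}"
    have "w \<in> rsa_lang det \<longleftrightarrow> (\<exists>s\<in>accepting det. \<exists>f.
        run (rsa_step det) (conf (I \<times> {None :: 'd option})) w (s, f))"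
      unfolding init[symmetric] by (simp add: rsa_lang_def det_def)
    also have "\<dots> \<longleftrightarrow> fst (conf ?C) \<in> accepting det"
      unfolding run by (cases "conf ?C") auto
    also have "\<dots> \<longleftrightarrow> w \<in> {w. \<exists>q\<in>I. \<exists>s\<in>F. \<exists>v :: 'd option. run move_step (q, None) w (s, v)}"
      unfolding acc by auto
    finally show "w \<in> rsa_lang det \<longleftrightarrow>
        w \<in> {w. \<exists>q\<in>I. \<exists>s\<in>F. \<exists>v :: 'd option. run move_step (q, None) w (s, v)}" .
  qed
qed

end


section \<open>From one-register automata to moves\<close>

text \<open>
  \<open>e\<close> enumerates the states.  If there is no register at all, its content is modelled as
  constantly \<open>\<bottom>\<close>.
\<close>

definition moves :: "('q, 'r, 'a) nra \<Rightarrow> 'r \<Rightarrow> nat \<Rightarrow> (nat \<Rightarrow> 'q) \<Rightarrow>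
    (nat \<times> 'a \<times> bool \<times> 'r src option \<times> nat) set" where
  "moves A r k e = {(m, a, E \<noteq> {}, if r \<in> registers A then up r else None, n) | m a E N up n.
     m < k \<and> n < k \<and> (e m, a, E, N, up, e n) \<in> transitions A}"

lemma wf_automaton_transition:
  assumes "wf_automaton U A" and "(q, a, P, N, up, s) \<in> transitions A"
  shows "s \<in> states A" "P \<subseteq> registers A" "up \<in> registers A \<rightarrow>\<^sub>E U"
proof -
  have "\<forall>(q, a, P, N, up, s) \<in> transitions A. s \<in> states A \<and> P \<subseteq> registers A \<and> up \<in> registers A \<rightarrow>\<^sub>E U"
    using assms(1) unfolding wf_automaton_def by fast
  from bspec[OF this assms(2)] show "s \<in> states A" "P \<subseteq> registers A" "up \<in> registers A \<rightarrow>\<^sub>E U"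
    by simp_all
qed

text \<open>With at most one register, a valuation is a constant on \<open>registers A\<close>, and
  an equality guard matters only through being nonempty.\<close>

lemma nra_step_moves:
  assumes A: "is_nra A" "no_disequality_guards A" and r: "registers A \<subseteq> {r}"
    and e: "e ` {..<k} = states A" and M: "one_register k (moves A r k e) I F" and m: "m < k"
  shows "nra_step A (e m, \<lambda>_\<in>registers A. v) (a, d) y \<longleftrightarrow>
    (\<exists>n v'. y = (e n, \<lambda>_\<in>registers A. v') \<and>
      one_register.move_step (moves A r k e) (m, v) (a, d) (n, v'))"
proof -
  have wf: "s \<in> states A \<and> E \<subseteq> registers A \<and> N = {} \<and>
      up \<in> registers A \<rightarrow>\<^sub>E Some ` Reg ` registers A \<union> {Some In, None}"
    if "(q, b, E, N, up, s) \<in> transitions A" for q b E N up s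
  proof -
    have "N = {}"
      using A(2)[unfolded no_disequality_guards_def, THEN bspec, OF that] by simp
    then show ?thesis
      using wf_automaton_transition[OF A(1)[unfolded is_nra_def] that] by blast
  qed
  have guard: "(\<forall>r\<in>E. (\<lambda>_\<in>registers A. v) r = Some d) \<longleftrightarrow> (E \<noteq> {} \<longrightarrow> v = Some d)"
    if "E \<subseteq> registers A" for E
    using that r by (auto simp: restrict_def)
  \<comment> \<open>A register named by an update belongs to \<open>registers A\<close>, so it can
    only be \<open>r\<close> and its content is \<open>v\<close>.\<close>
  have update: "(\<lambda>r\<in>registers A. nra_update (\<lambda>_\<in>registers A. v) d (up r)) =
      (\<lambda>_\<in>registers A. nra_update (\<lambda>_. v) d (if r \<in> registers A then up r else None))"
    if "up \<in> registers A \<rightarrow>\<^sub>E Some ` Reg ` registers A \<union> {Some In, None}" for up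
    using r that by (intro restrict_ext) (auto dest!: PiE_mem)
  have step: "one_register.move_step (moves A r k e) (m, v) (a, d) (n, v') \<longleftrightarrow>
      n < k \<and> (\<exists>E N up. (e m, a, E, N, up, e n) \<in> transitions A \<and> (E \<noteq> {} \<longrightarrow> v = Some d) \<and>
        v' = nra_update (\<lambda>_. v) d (if r \<in> registers A then up r else None))" (is "?L \<longleftrightarrow> ?R") for n v'
  proof
    assume ?L
    then show ?R
      unfolding one_register.move_step_def[OF M] prod.case
      unfolding moves_def mem_Collect_eq prod.inject
      by (elim exE conjE) (simp, blast)
  next
    assume ?R
    then show ?L
      unfolding one_register.move_step_def[OF M] prod.case
      unfolding moves_def mem_Collect_eq prod.inject
      using m by blast
  qed
  obtain s f' where y: "y = (s, f')" by (cases y)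
  have "nra_step A (e m, \<lambda>_\<in>registers A. v) (a, d) y \<longleftrightarrow>
      (\<exists>E N up. (e m, a, E, N, up, s) \<in> transitions A \<and> (E \<noteq> {} \<longrightarrow> v = Some d) \<and>
        f' = (\<lambda>_\<in>registers A.
          nra_update (\<lambda>_. v) d (if r \<in> registers A then up r else None)))"
    unfolding y nra_step_def prod.case
  proof (intro ex_cong1 conj_cong refl)
    fix E N up
    assume "(e m, a, E, N, up, s) \<in> transitions A"
    note t = wf[OF this]
    show "(\<forall>r\<in>E. (\<lambda>_\<in>registers A. v) r = Some d) \<longleftrightarrow> (E \<noteq> {} \<longrightarrow> v = Some d)"
      using t guard by blast
    show "(\<forall>r\<in>N. (\<lambda>_\<in>registers A. v) r \<noteq> Some d) \<and>
        f' = (\<lambda>r\<in>registers A. nra_update (\<lambda>_\<in>registers A. v) d (up r)) \<longleftrightarrow>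
      f' = (\<lambda>_\<in>registers A. nra_update (\<lambda>_. v) d (if r \<in> registers A then up r else None))"
      using t update[of up] by simp
  qed
  \<comment> \<open>The target lies in \<open>states A\<close> and so has a number below
    \<open>k\<close>.\<close>
  also have "\<dots> \<longleftrightarrow> (\<exists>n<k. s = e n \<and> (\<exists>E N up. (e m, a, E, N, up, e n) \<in> transitions A \<and>
      (E \<noteq> {} \<longrightarrow> v = Some d) \<and> f' = (\<lambda>_\<in>registers A.
          nra_update (\<lambda>_. v) d (if r \<in> registers A then up r else None))))"
    (is "?L \<longleftrightarrow> ?R")
  proof
    assume ?L
    moreover from this have "s \<in> e ` {..<k}" using wf e by blast
    ultimately show ?R by blast
  next
    assume ?R
    then show ?L by blast
  qed
  also have "\<dots> \<longleftrightarrow> (\<exists>n v'. y = (e n, \<lambda>_\<in>registers A. v') \<and>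
      one_register.move_step (moves A r k e) (m, v) (a, d) (n, v'))"
    unfolding y step prod.inject by blast
  finally show ?thesis .
qed

theorem theorem5p2:
  fixes A :: "('q, 'r, 'a::finite) nra"
  assumes "is_nra A"
    and "card (registers A) \<le> 1"
    and "no_disequality_guards A"
  shows "\<exists>B :: (nat, nat, 'a) rsa. is_rsa B \<and> deterministic_rsa B \<and>
           rsa_lang B = (nra_lang A :: ('a \<times> 'd::infinite) list set)"
proof -
  have fin: "finite (states A)" "finite (registers A)"
    and IF: "initial A \<subseteq> states A" "accepting A \<subseteq> states A"
    using assms(1) by (auto simp: is_nra_def wf_automaton_def)
  \<comment> \<open>If there is no register, \<open>r\<close> is arbitrary.\<close>
  obtain r where r: "registers A \<subseteq> {r}"
    using assms(2) fin(2) by (metis card_le_Suc0_iff_eq One_nat_def insertCI subsetI)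
  obtain e where "bij_betw e {0..<card (states A)} (states A)"
    using ex_bij_betw_nat_finite[OF fin(1)] by blast
  then obtain k where e: "e ` {..<k} = states A"
    by (auto simp: bij_betw_def atLeast0LessThan)
  define I F where IF_def: "I = {n. n < k \<and> e n \<in> initial A}" "F = {n. n < k \<and> e n \<in> accepting A}"
  interpret one_register k "moves A r k e" I F
    by unfold_locales (auto simp: moves_def IF_def)
  \<comment> \<open>Without registers \<open>h\<close> forgets \<open>v\<close>;
    \<open>run_simulation\<close> permits this.\<close>
  define h :: "nat \<times> 'd option \<Rightarrow> 'q \<times> ('r \<Rightarrow> 'd option)"
    where "h = (\<lambda>(n, v). (e n, \<lambda>_\<in>registers A. v))"
  have run: "run (nra_step A) (h c) w y \<longleftrightarrow> (\<exists>c'. y = h c' \<and> run move_step c w c')"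
    if "fst c < k" for c w y
  proof (rule run_simulation[where P = "\<lambda>c. fst c < k"])
    show "nra_step A (h c) x y \<longleftrightarrow> (\<exists>c'. y = h c' \<and> move_step c x c')" if "fst c < k" for c x y
      using that
      by (cases c; cases x)
        (simp add: h_def nra_step_moves[OF assms(1,3) r e one_register_axioms])
    show "fst c' < k" if "move_step c x c'" for c c' :: "nat \<times> 'd option" and x
      using that by (cases c; cases x; cases c') (auto simp: move_step_def dest: moves_bounded)
  qed fact
  have run': "run (nra_step A) (e m, \<lambda>_\<in>registers A. None :: 'd option) w y \<longleftrightarrow>
      (\<exists>n v. y = (e n, \<lambda>_\<in>registers A. v) \<and> run move_step (m, None) w (n, v))" if "m < k" for m w y
    using run[of "(m, None)"] that by (simp add: h_def)
  \<comment> \<open>Membership in \<open>F\<close> includes \<open>n < k\<close>, so the end of an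
    accepting run must be known to be bounded.\<close>
  have bounded: "n < k" if "run move_step c w (n, v)" "fst c < k"
    for c w n and v :: "'d option"
    using that by (induction c w "(n, v)" rule: run.induct)
      (auto simp: move_step_def dest: moves_bounded)
  have "nra_lang A = {w. \<exists>m\<in>I. \<exists>n\<in>F. \<exists>v :: 'd option. run move_step (m, None) w (n, v)}"
  proof -
    have "initial A = e ` I"
      using e IF(1) by (auto simp: IF_def)
    then have "nra_lang A = {w. \<exists>m\<in>I. \<exists>s\<in>accepting A. \<exists>f :: 'r \<Rightarrow> 'd option.
        run (nra_step A) (e m, \<lambda>_\<in>registers A. None) w (s, f)}"
      by (simp add: nra_lang_def)
    also have "\<dots> = {w. \<exists>m\<in>I. \<exists>n\<in>F. \<exists>v :: 'd option. run move_step (m, None) w (n, v)}"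
      using run' bounded unfolding IF_def by fastforce
    finally show ?thesis .
  qed
  then have "rsa_lang det = (nra_lang A :: ('a \<times> 'd) list set)"
    by (simp add: rsa_lang_det)
  with is_rsa_det deterministic_det show ?thesis by blast
qed

end
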